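(* Let $k\ge2$ and let $(x_n)_{n\in\mathbb{N}}\subseteq[0,1]$ have Poissonian $k$-th order correlations. Then: (i) $\lim_{N\to\infty}I_k(s,N)=s^k$ for all $s>0$. (ii) $\limsup_{N\to\infty}I_k^*(s,N)=s^k+\mathcal{O}_k(s^{k-1})$ as $s\to\infty$. (iii) If in addition $(x_n)$ has Poissonian $\ell$-th order correlations for all $2\le\ell\le k$, then for every $s>0$ $$\lim_{N\to\infty}I_k^*(s,N)=s^k+c_{k,k-1}s^{k-1}+\dots+c_{k,1}s,$$ where $c_{k,i}$ ($1\le i\le k-1$) are the Stirling numbers of the second kind.
   Context: $\|x\|$ is the distance of $x$ to the nearest integer and $(\!(x)\!)$ the signed distance of $x$ from the origin mod 1 ($=\{x\}$ if $\{x\}\le\frac12$, $=\{x\}-1$ otherwise). For compactly supported $f:\mathbb{R}^{k-1}\to[0,\infty)$, $R_k(f,N)=\frac1N\sum_{i_1,\dots,i_k\le N\text{ distinct}}f(N(\!(x_{i_1}-x_{i_2})\!),\dots,N(\!(x_{i_1}-x_{i_k})\!))$; Poissonian $k$-th order correlations means $\lim_NR_k(f,N)=\int_{\mathbb{R}^{k-1}}f$ for all $f\in C_c(\mathbb{R}^{k-1})$. For $s>0$, $N\ge1$, $t\in[0,1]$ let $F(t,s,N)=\#\{n\le N:\|x_n-t\|\le s/(2N)\}$, and $I_k(s,N)=\int_0^1F(t,s,N)(F(t,s,N)-1)\cdots(F(t,s,N)-(k-1))\,dt$, $I_k^*(s,N)=\int_0^1F(t,s,N)^k\,dt$. In (ii),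 the $\mathcal{O}_k$ means there are constants $C_k,s_0>0$ (depending on $k$) with $|\limsup_N I_k^*(s,N)-s^k|\le C_ks^{k-1}$ for $s\ge s_0$. *)

theory Defs
  imports "HOL-Analysis.Analysis" "HOL-Combinatorics.Stirling"
begin

definition dist_int :: "real \<Rightarrow> real" where
  "dist_int x = \<bar>x - of_int (round x)\<bar>"

definition signed_dist :: "real \<Rightarrow> real" where
  "signed_dist x = (if frac x \<le> 1/2 then frac x else frac x - 1)"

(* Since the dimension k - 1 varies, R^(k-1) is represented by the extensional functions
   on the index set {2..k}; coordinate j carries the difference of the points with
   indices i_1 and i_j. *)

definition nonneg_Cc :: "nat set \<Rightarrow> ((nat \<Rightarrow> real) \<Rightarrow> real) set" where
  "nonneg_Cc J = {f.
     continuous_map (powertop_real J) euclideanreal f \<and>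
     (\<forall>u \<in> J \<rightarrow>\<^sub>E UNIV. 0 \<le> f u) \<and>
     (\<exists>K. compactin (powertop_real J) K \<and>
          (\<forall>u \<in> (J \<rightarrow>\<^sub>E UNIV) - K. f u = 0))}"

definition distinct_tuples :: "nat \<Rightarrow> nat \<Rightarrow> (nat \<Rightarrow> nat) set" where
  "distinct_tuples k N = {i \<in> {1..k} \<rightarrow>\<^sub>E {1..N}. inj_on i {1..k}}"

(* Sequences are indexed from 1; the value x 0 is never used. *)

definition corr :: "(nat \<Rightarrow> real) \<Rightarrow> nat \<Rightarrow> ((nat \<Rightarrow> real) \<Rightarrow> real) \<Rightarrow> nat \<Rightarrow> real" where
  "corr x k f N = (1 / real N) *
     (\<Sum>i\<in>distinct_tuples k N. f (\<lambda>j\<in>{2..k}. real N * signed_dist (x (i 1) - x (i j))))"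

(* Nonnegative test functions suffice: splitting into positive and negative parts shows that
   this is the same as testing against all real-valued continuous functions of compact support. *)

definition poissonian_correlations :: "nat \<Rightarrow> (nat \<Rightarrow> real) \<Rightarrow> bool" where
  "poissonian_correlations k x \<longleftrightarrow>
     (\<forall>f\<in>nonneg_Cc {2..k}.
        (\<lambda>N. corr x k f N) \<longlonglongrightarrow> (LINT u|Pi\<^sub>M {2..k} (\<lambda>_. lborel). f u))"

definition F_count :: "(nat \<Rightarrow> real) \<Rightarrow> real \<Rightarrow> real \<Rightarrow> nat \<Rightarrow> nat" where
  "F_count x t s N = card {n\<in>{1..N}. dist_int (x n - t) \<le> s / (2 * real N)}"

definition I_fact :: "(nat \<Rightarrow> real) \<Rightarrow> nat \<Rightarrow> real \<Rightarrow> nat \<Rightarrow> real" where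
  "I_fact x k s N = (LINT t:{0..1}|lborel. (\<Prod>j<k. real (F_count x t s N) - real j))"

definition I_star :: "(nat \<Rightarrow> real) \<Rightarrow> nat \<Rightarrow> real \<Rightarrow> nat \<Rightarrow> real" where
  "I_star x k s N = (LINT t:{0..1}|lborel. real (F_count x t s N) ^ k)"

end

theory Submission
  imports Defs
begin

text \<open>
  The falling factorial of \<open>F(t,s,N)\<close> counts the injective \<open>k\<close>-tuples of indices whose points all
  lie within \<open>s/(2N)\<close> of \<open>t\<close>. Integrating over \<open>t\<close>, a tuple contributes the length of an
  intersection of \<open>k\<close> arcs, which for \<open>N > 2s\<close> is \<open>1/N\<close> times a continuous, compactly supported
  function of the scaled signed differences. So \<open>I\<^sub>k(s,N)\<close> is itself a correlation sum, and by Fubini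
  the integral of that test function is \<open>s\<^sup>k\<close>; this is (i). Expanding \<open>F\<^sup>k\<close> in falling factorials gives
  (iii). For (ii), \<open>F\<^sup>k\<close> exceeds the falling factorial by at most \<open>k\<^sup>2 F\<^sup>k\<^sup>-\<^sup>1\<close>, and
  \<open>F\<^sup>k\<^sup>-\<^sup>1 \<le> s\<^sup>k\<^sup>-\<^sup>1 + F\<^sup>k/s\<close>, whose last term can be absorbed once \<open>s\<close> is large.
\<close>

section \<open>Intersections of translated intervals as a test function\<close>

lemma continuous_map_Max_insert_0:
  assumes "finite J" "\<And>j. j \<in> J \<Longrightarrow> continuous_map T euclideanreal (f j)"
  shows "continuous_map T euclideanreal (\<lambda>u. Max (insert 0 ((\<lambda>j. f j u) ` J)))"
  using assms
proof (induction J rule: finite_induct)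
  case (insert a J)
  have "(\<lambda>u. Max (insert 0 ((\<lambda>j. f j u) ` insert a J))) = (\<lambda>u. max (f a u) (Max (insert 0 ((\<lambda>j. f j u) ` J))))"
    using insert.hyps by (subst image_insert, subst insert_commute, subst Max_insert) auto
  then show ?case
    using insert by (auto intro!: continuous_map_real_max)
qed auto

lemma borel_measurable_Max_insert_0:
  fixes f :: "'b \<Rightarrow> 'a \<Rightarrow> real"
  assumes "finite J" "\<And>j. j \<in> J \<Longrightarrow> f j \<in> borel_measurable M"
  shows "(\<lambda>u. Max (insert 0 ((\<lambda>j. f j u) ` J))) \<in> borel_measurable M"
  using assms
proof (induction J rule: finite_induct)
  case (insert a J)
  have "(\<lambda>u. Max (insert 0 ((\<lambda>j. f j u) ` insert a J))) = (\<lambda>u. max (f a u) (Max (insert 0 ((\<lambda>j. f j u) ` J))))"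
    using insert.hyps by (subst image_insert, subst insert_commute, subst Max_insert) auto
  then show ?case
    using insert by (auto intro!: borel_measurable_max)
qed auto

text \<open>This is the length of the intersection of \<open>[-s/2, s/2]\<close> with its translates
  by \<open>- u j\<close>. The \<open>0\<close> inserted in both maxima stands for the untranslated
  interval and keeps \<open>Max\<close> meaningful for empty \<open>J\<close>; the outer
  \<open>max\<close> covers an empty intersection.\<close>

definition overlap :: "real \<Rightarrow> nat set \<Rightarrow> (nat \<Rightarrow> real) \<Rightarrow> real" where
  "overlap s J u = max 0 (s - Max (insert 0 (u ` J)) - Max (insert 0 ((\<lambda>j. - u j) ` J)))"

lemma overlap_nonneg: "0 \<le> overlap s J u"
  by (simp add: overlap_def)

lemma overlap_interval:
  fixes s :: real
  assumes "finite J"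
  shows "{v. \<bar>v\<bar> \<le> s / 2 \<and> (\<forall>j\<in>J. \<bar>u j + v\<bar> \<le> s / 2)} =
    {- s / 2 + Max (insert 0 ((\<lambda>j. - u j) ` J)) .. s / 2 - Max (insert 0 (u ` J))}"
proof -
  have "Max (insert 0 ((\<lambda>j. - u j) ` J)) \<le> v + s / 2 \<longleftrightarrow> 0 \<le> v + s / 2 \<and> (\<forall>j\<in>J. - u j \<le> v + s / 2)" for v
    using assms by (subst Max_le_iff) auto
  moreover have "Max (insert 0 (u ` J)) \<le> s / 2 - v \<longleftrightarrow> 0 \<le> s / 2 - v \<and> (\<forall>j\<in>J. u j \<le> s / 2 - v)" for v
    using assms by (subst Max_le_iff) auto
  moreover have "\<bar>v\<bar> \<le> s / 2 \<and> (\<forall>j\<in>J. \<bar>u j + v\<bar> \<le> s / 2) \<longleftrightarrow>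
      (0 \<le> v + s / 2 \<and> (\<forall>j\<in>J. - u j \<le> v + s / 2)) \<and> (0 \<le> s / 2 - v \<and> (\<forall>j\<in>J. u j \<le> s / 2 - v))" for v
  proof -
    have "\<bar>w + v\<bar> \<le> s / 2 \<longleftrightarrow> - w \<le> v + s / 2 \<and> w \<le> s / 2 - v" for w
      by linarith
    from this this[of 0] show ?thesis by auto
  qed
  ultimately have "\<bar>v\<bar> \<le> s / 2 \<and> (\<forall>j\<in>J. \<bar>u j + v\<bar> \<le> s / 2) \<longleftrightarrow>
      Max (insert 0 ((\<lambda>j. - u j) ` J)) \<le> v + s / 2 \<and> Max (insert 0 (u ` J)) \<le> s / 2 - v" for v
    by presburger
  then show ?thesis
    by (simp add: set_eq_iff algebra_simps)
qed

lemma emeasure_overlap: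
  assumes "finite J"
  shows "emeasure lborel {v. \<bar>v\<bar> \<le> s / 2 \<and> (\<forall>j\<in>J. \<bar>u j + v\<bar> \<le> s / 2)} = ennreal (overlap s J u)"
  unfolding overlap_interval[OF assms]
  by (auto simp: overlap_def emeasure_lborel_Icc_eq max_def algebra_simps ennreal_neg)

text \<open>One of the two maxima is at least \<open>\<bar>u j\<bar>\<close> and the other is
  nonnegative. This bounds the support of \<open>overlap\<close> by the cube of half-width
  \<open>s\<close>.\<close>

lemma overlap_eq_0:
  assumes "finite J" "j \<in> J" "s < \<bar>u j\<bar>"
  shows "overlap s J u = 0"
proof -
  have "u j \<le> Max (insert 0 (u ` J))" "- u j \<le> Max (insert 0 ((\<lambda>j. - u j) ` J))"
       "0 \<le> Max (insert 0 (u ` J))" "0 \<le> Max (insert 0 ((\<lambda>j. - u j) ` J))"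
    using assms by (auto intro!: Max_ge)
  then show ?thesis
    unfolding overlap_def using assms by linarith
qed

lemma overlap_in_nonneg_Cc:
  assumes "finite J"
  shows "overlap s J \<in> nonneg_Cc J"
  unfolding nonneg_Cc_def
proof (intro CollectI conjI exI)
  show "continuous_map (powertop_real J) euclideanreal (overlap s J)"
    unfolding overlap_def
    by (intro continuous_map_real_max continuous_map_diff continuous_map_Max_insert_0 assms
        continuous_map_minus continuous_map_product_projection) auto
  show "\<forall>u\<in>J \<rightarrow>\<^sub>E UNIV. 0 \<le> overlap s J u"
    by (simp add: overlap_nonneg)
  show "compactin (powertop_real J) (J \<rightarrow>\<^sub>E {-s..s})"
    by (auto simp: compactin_PiE)
  show "\<forall>u\<in>(J \<rightarrow>\<^sub>E UNIV) - (J \<rightarrow>\<^sub>E {-s..s}). overlap s J u = 0"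
  proof
    fix u assume "u \<in> (J \<rightarrow>\<^sub>E UNIV) - (J \<rightarrow>\<^sub>E {-s..s})"
    then obtain j where "j \<in> J" "u j \<notin> {-s..s}"
      by (auto simp: PiE_def Pi_def)
    then show "overlap s J u = 0"
      by (intro overlap_eq_0[OF assms]) auto
  qed
qed

lemma overlap_measurable: "finite J \<Longrightarrow> overlap s J \<in> borel_measurable (Pi\<^sub>M J (\<lambda>_. lborel))"
  unfolding overlap_def
  by (intro borel_measurable_max borel_measurable_diff borel_measurable_Max_insert_0
      borel_measurable_const borel_measurable_uminus) auto

text \<open>Writing \<open>overlap\<close> as an integral over \<open>v\<close> and exchanging the
  integrals leaves, for fixed \<open>v\<close>, a product of independent integrals, each equal to
  \<open>s\<close>. The integral over \<open>v\<close> itself supplies the extra factor behind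
  \<open>Suc\<close>.\<close>

lemma integral_overlap:
  assumes J: "finite J" and s: "0 \<le> s"
  shows "(LINT u|Pi\<^sub>M J (\<lambda>_. lborel). overlap s J u) = s ^ Suc (card J)"
proof -
  interpret P: finite_product_sigma_finite "\<lambda>_. lborel :: real measure" J
    by standard (use J in auto)
  interpret PP: pair_sigma_finite "Pi\<^sub>M J (\<lambda>_. lborel :: real measure)" "lborel :: real measure" ..
  let ?b = "\<lambda>v. indicator {- s / 2..s / 2} v :: ennreal"
  \<comment> \<open>The product form is what allows integration coordinate by coordinate.\<close>
  have ind: "indicator {v. \<bar>v\<bar> \<le> s / 2 \<and> (\<forall>j\<in>J. \<bar>u j + v\<bar> \<le> s / 2)} v = ?b v * (\<Prod>j\<in>J. ?b (u j + v))" for u v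
  proof (cases "\<forall>j\<in>J. \<bar>u j + v\<bar> \<le> s / 2")
    case True
    then have "(\<Prod>j\<in>J. ?b (u j + v)) = 1"
    proof (intro prod.neutral ballI)
      fix j assume "j \<in> J"
      with True have "\<bar>u j + v\<bar> \<le> s / 2" by blast
      then have "u j + v \<in> {- s / 2..s / 2}"
        unfolding atLeastAtMost_iff by linarith
      then show "?b (u j + v) = 1" by (rule indicator_simps)
    qed
    with True show ?thesis by (auto simp: indicator_def abs_le_iff)
  next
    case False
    then obtain j where "j \<in> J" "\<not> \<bar>u j + v\<bar> \<le> s / 2" by blast
    moreover from this have "u j + v \<notin> {- s / 2..s / 2}"
      unfolding atLeastAtMost_iff by linarith
    ultimately have "\<exists>j\<in>J. ?b (u j + v) = 0"
      by (metis indicator_simps(2))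
    then have "(\<Prod>j\<in>J. ?b (u j + v)) = 0"
      using J by auto
    with False show ?thesis by (auto simp: indicator_def)
  qed
  have "(\<integral>\<^sup>+u. ennreal (overlap s J u) \<partial>Pi\<^sub>M J (\<lambda>_. lborel)) =
      (\<integral>\<^sup>+u. (\<integral>\<^sup>+v. ?b v * (\<Prod>j\<in>J. ?b (u j + v)) \<partial>lborel) \<partial>Pi\<^sub>M J (\<lambda>_. lborel))"
  proof (intro nn_integral_cong)
    fix u
    have "{v. \<bar>v\<bar> \<le> s / 2 \<and> (\<forall>j\<in>J. \<bar>u j + v\<bar> \<le> s / 2)} \<in> sets lborel"
      by (simp add: overlap_interval[OF J])
    then show "ennreal (overlap s J u) = (\<integral>\<^sup>+v. ?b v * (\<Prod>j\<in>J. ?b (u j + v)) \<partial>lborel)"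
      unfolding emeasure_overlap[OF J, symmetric] ind[symmetric] by simp
  qed
  also have "\<dots> = (\<integral>\<^sup>+v. (\<integral>\<^sup>+u. ?b v * (\<Prod>j\<in>J. ?b (u j + v)) \<partial>Pi\<^sub>M J (\<lambda>_. lborel)) \<partial>lborel)"
    by (intro PP.Fubini'[symmetric]) measurable
  also have "\<dots> = (\<integral>\<^sup>+v. ?b v * ennreal s ^ card J \<partial>lborel)"
  proof (intro nn_integral_cong)
    fix v :: real
    \<comment> \<open>By translation invariance the value does not depend on
      \<open>v\<close>.\<close>
    have one: "(\<integral>\<^sup>+w. ?b (w + v) \<partial>lborel) = ennreal s"
      using nn_integral_real_affine[of ?b 1 v] s by (simp add: add.commute)
    have "(\<integral>\<^sup>+u. ?b v * (\<Prod>j\<in>J. ?b (u j + v)) \<partial>Pi\<^sub>M J (\<lambda>_. lborel)) =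
        ?b v * (\<integral>\<^sup>+u. (\<Prod>j\<in>J. ?b (u j + v)) \<partial>Pi\<^sub>M J (\<lambda>_. lborel))"
      by (intro nn_integral_cmult) measurable
    also have "(\<integral>\<^sup>+u. (\<Prod>j\<in>J. ?b (u j + v)) \<partial>Pi\<^sub>M J (\<lambda>_. lborel)) = (\<Prod>j\<in>J. \<integral>\<^sup>+w. ?b (w + v) \<partial>lborel)"
      by (intro P.product_nn_integral_prod J) measurable
    finally show "(\<integral>\<^sup>+u. ?b v * (\<Prod>j\<in>J. ?b (u j + v)) \<partial>Pi\<^sub>M J (\<lambda>_. lborel)) = ?b v * ennreal s ^ card J"
      by (simp only: one prod_constant)
  qed
  also have "\<dots> = ennreal (s ^ Suc (card J))"
    using s by (subst nn_integral_multc) (auto simp: ennreal_power ennreal_mult)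
  finally have "(\<integral>\<^sup>+u. ennreal (overlap s J u) \<partial>Pi\<^sub>M J (\<lambda>_. lborel)) = ennreal (s ^ Suc (card J))" .
  then show ?thesis
    using s by (subst integral_eq_nn_integral) (auto simp: overlap_nonneg overlap_measurable J)
qed

section \<open>Distances modulo 1, periodicity and the measure of intersected arcs\<close>

lemma dist_int_measurable [measurable]: "dist_int \<in> borel_measurable borel"
  unfolding dist_int_def round_def by measurable

lemma dist_int_add_of_int: "dist_int (x + of_int n) = dist_int x"
  by (simp add: dist_int_def round_def add.assoc [symmetric] add.commute[of _ "1/2"])

lemma dist_int_minus_commute: "dist_int (x - y) = dist_int (y - x)"
proof (rule antisym)
  have "dist_int a \<le> dist_int (- a)" for a
    using round_diff_minimal[of a "- round (- a)"] by (simp add: dist_int_def abs_minus_commute)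
  from this[of "x - y"] this[of "y - x"]
  show "dist_int (x - y) \<le> dist_int (y - x)" "dist_int (y - x) \<le> dist_int (x - y)" by auto
qed

text \<open>The two bounds add up to 1, which forces \<open>round z = 0\<close>. The value 3/4 fits
  a signed distance, at most 1/2, plus a shift below 1/4.\<close>

lemma dist_int_le_iff:
  assumes "\<bar>z\<bar> < 3/4" "r < 1/4"
  shows "dist_int z \<le> r \<longleftrightarrow> \<bar>z\<bar> \<le> r"
proof
  assume "dist_int z \<le> r"
  moreover from this have "\<bar>real_of_int (round z)\<bar> < 1"
    using assms unfolding dist_int_def by linarith
  then have "round z = 0" by linarith
  ultimately show "\<bar>z\<bar> \<le> r" by (simp add: dist_int_def)
next
  assume "\<bar>z\<bar> \<le> r"
  then show "dist_int z \<le> r"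
    using round_diff_minimal[of z 0] by (simp add: dist_int_def)
qed

lemma signed_dist_cong: "\<exists>m. signed_dist x = x + of_int m"
  by (auto simp: signed_dist_def frac_def intro: exI[of _ "- floor x"] exI[of _ "- floor x - 1"])

lemma abs_signed_dist_le: "\<bar>signed_dist x\<bar> \<le> 1/2"
  using frac_ge_0[of x] frac_lt_1[of x] by (auto simp: signed_dist_def)

text \<open>The window is cut at the one integer in \<open>(a, a+1]\<close>. Shifted by integers,
  its two pieces tile \<open>[0, 1)\<close> in the opposite order; half-open intervals make the
  tiling exact.\<close>

lemma nn_integral_periodic:
  fixes f :: "real \<Rightarrow> ennreal"
  assumes [measurable]: "f \<in> borel_measurable borel" and f: "\<And>t n. f (t + of_int n) = f t"
  shows "(\<integral>\<^sup>+t. f t * indicator {a..<a+1} t \<partial>lborel) = (\<integral>\<^sup>+t. f t * indicator {0..<1} t \<partial>lborel)"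
proof -
  have shift: "(\<integral>\<^sup>+t. f t * indicator {b..<c} t \<partial>lborel) =
      (\<integral>\<^sup>+t. f t * indicator {b - of_int n..<c - of_int n} t \<partial>lborel)" for b c n
  proof -
    have "(\<integral>\<^sup>+t. f t * indicator {b..<c} t \<partial>lborel) =
        (\<integral>\<^sup>+t. f (t + of_int n) * indicator {b..<c} (t + of_int n) \<partial>lborel)"
      using nn_integral_real_affine[of "\<lambda>t. f t * indicator {b..<c} t" 1 "of_int n"]
      by (simp add: add.commute)
    also have "\<dots> = (\<integral>\<^sup>+t. f t * indicator {b - of_int n..<c - of_int n} t \<partial>lborel)"
      by (intro nn_integral_cong) (auto simp: f indicator_def)
    finally show ?thesis .
  qed
  have split: "(\<integral>\<^sup>+t. f t * indicator {b..<d} t \<partial>lborel) =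
      (\<integral>\<^sup>+t. f t * indicator {b..<c} t \<partial>lborel) + (\<integral>\<^sup>+t. f t * indicator {c..<d} t \<partial>lborel)"
    if "b \<le> c" "c \<le> d" for b c d
    using that by (subst nn_integral_add[symmetric]) (auto intro!: nn_integral_cong simp: indicator_def)
  define n where "n = \<lfloor>a\<rfloor>"
  have n: "of_int n \<le> a" "a < of_int n + 1"
    unfolding n_def by linarith+
  have "(\<integral>\<^sup>+t. f t * indicator {a..<a+1} t \<partial>lborel) =
      (\<integral>\<^sup>+t. f t * indicator {a..<of_int n+1} t \<partial>lborel) + (\<integral>\<^sup>+t. f t * indicator {of_int n+1..<a+1} t \<partial>lborel)"
    using n by (intro split) auto
  also have "\<dots> = (\<integral>\<^sup>+t. f t * indicator {a-of_int n..<1} t \<partial>lborel) + (\<integral>\<^sup>+t. f t * indicator {0..<a-of_int n} t \<partial>lborel)"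
    \<comment> \<open>The left piece moves by \<open>n\<close>, the right piece by
      \<open>n + 1\<close>.\<close>
    by (subst shift[of a _ n], subst shift[of _ "a + 1" "n + 1"]) simp
  also have "\<dots> = (\<integral>\<^sup>+t. f t * indicator {0..<1} t \<partial>lborel)"
    using n by (subst add.commute, intro split[symmetric]) auto
  finally show ?thesis .
qed

text \<open>For \<open>N > 2 * s\<close> the arcs have radius below 1/4. Seen from a unit window
  centred at \<open>y 1\<close> they do not wrap around, so the circle conditions become conditions
  on intervals of the line, rescaled by \<open>N\<close>.\<close>

lemma emeasure_arcs:
  fixes y :: "nat \<Rightarrow> real" and N :: nat
  assumes k: "k \<ge> 1" and N: "real N > 2 * s" "N > 0" 
  shows "emeasure lborel ({0..1} \<inter> {t. \<forall>j\<in>{1..k}. dist_int (y j - t) \<le> s / (2 * real N)}) =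
    ennreal (overlap s {2..k} (\<lambda>j\<in>{2..k}. real N * signed_dist (y 1 - y j)) / real N)"
proof -
  define r where "r = s / (2 * real N)"
  define E where "E = {t. \<forall>j\<in>{1..k}. dist_int (y j - t) \<le> r}"
  define u where "u = (\<lambda>j\<in>{2..k}. real N * signed_dist (y 1 - y j))"
  have [measurable]: "E \<in> sets borel"
    unfolding E_def by measurable
  have r: "r < 1/4"
    using N by (simp add: r_def field_simps)
  have per: "indicator E (t + of_int n) = (indicator E t :: ennreal)" for t n
  proof -
    have "dist_int (y j - (t + of_int n)) = dist_int (y j - t)" for j
      using dist_int_add_of_int[of "y j - t" "- n"] by (simp add: algebra_simps)
    then show ?thesis by (simp add: E_def indicator_def)
  qed
  \<comment> \<open>Here \<open>v\<close> is \<open>N\<close> times the displacement of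
    \<open>t\<close> from \<open>y 1\<close>.\<close>
  have key: "indicator E (y 1 + 1 / real N * v) * indicator {y 1 - 1/2..<y 1 - 1/2 + 1} (y 1 + 1 / real N * v)
      = (indicator {v. \<bar>v\<bar> \<le> s / 2 \<and> (\<forall>j\<in>{2..k}. \<bar>u j + v\<bar> \<le> s / 2)} v :: ennreal)" (is "?L = ?R") for v
  proof -
    define \<tau> where "\<tau> = v / real N"
    have v: "v = real N * \<tau>" using N by (simp add: \<tau>_def)
    have scale: "\<bar>real N * w\<bar> \<le> s / 2 \<longleftrightarrow> \<bar>w\<bar> \<le> r" for w
      using N by (simp add: r_def abs_mult field_simps)
    \<comment> \<open>Up to sign, the two arguments differ by an integer.\<close>
    have sd: "dist_int (y j - (y 1 + \<tau>)) = dist_int (signed_dist (y 1 - y j) + \<tau>)" for j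
    proof -
      obtain m where m: "signed_dist (y 1 - y j) = y 1 - y j + of_int m"
        using signed_dist_cong by blast
      have "dist_int (y j - (y 1 + \<tau>)) = dist_int (y 1 + \<tau> - y j)"
        by (rule dist_int_minus_commute)
      also have "\<dots> = dist_int (y 1 + \<tau> - y j + of_int m)"
        by (simp add: dist_int_add_of_int)
      also have "y 1 + \<tau> - y j + of_int m = signed_dist (y 1 - y j) + \<tau>"
        using m by (simp add: algebra_simps)
      finally show ?thesis .
    qed
    have sd1: "signed_dist (y 1 - y 1) = 0"
      by (simp add: signed_dist_def)
    have ins: "{1..k} = insert 1 {2..k}" using k by auto
    \<comment> \<open>If \<open>\<bar>\<tau>\<bar> \<le> r\<close>, all arguments stay below 3/4 and
      \<open>dist_int\<close> may be replaced by the absolute value. Otherwise the condition for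
      \<open>j = 1\<close> fails and both sides are false.\<close>
    have E_iff: "y 1 + \<tau> \<in> E \<longleftrightarrow> \<bar>\<tau>\<bar> \<le> r \<and> (\<forall>j\<in>{2..k}. \<bar>signed_dist (y 1 - y j) + \<tau>\<bar> \<le> r)"
      if "\<bar>\<tau>\<bar> \<le> 1/2"
    proof (cases "\<bar>\<tau>\<bar> \<le> r")
      case True
      then have "\<bar>signed_dist (y 1 - y j) + \<tau>\<bar> < 3/4" for j
        using abs_signed_dist_le[of "y 1 - y j"] r by linarith
      then show ?thesis
        using dist_int_le_iff[of "signed_dist (y 1 - y _) + \<tau>" r] dist_int_le_iff[of \<tau> r] r that
        unfolding E_def mem_Collect_eq ins ball_simps sd sd1 by auto
    next
      case False
      then show ?thesis
        using dist_int_le_iff[of \<tau> r] r that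
        unfolding E_def mem_Collect_eq ins ball_simps sd sd1 by auto
    qed
    have "u j + v = real N * (signed_dist (y 1 - y j) + \<tau>)" if "j \<in> {2..k}" for j
      using that by (simp add: u_def v algebra_simps)
    then have "(\<forall>j\<in>{2..k}. \<bar>u j + v\<bar> \<le> s / 2) \<longleftrightarrow> (\<forall>j\<in>{2..k}. \<bar>signed_dist (y 1 - y j) + \<tau>\<bar> \<le> r)"
      by (intro ball_cong refl) (simp only: scale)
    moreover have "\<bar>v\<bar> \<le> s / 2 \<longleftrightarrow> \<bar>\<tau>\<bar> \<le> r"
      unfolding v by (rule scale)
    \<comment> \<open>Admissible shifts lie inside the unit window, so restricting to it loses
      nothing.\<close>
    moreover have "\<bar>\<tau>\<bar> \<le> r \<Longrightarrow> - (1/2) \<le> \<tau> \<and> \<tau> < 1/2" "- (1/2) \<le> \<tau> \<and> \<tau> < 1/2 \<Longrightarrow> \<bar>\<tau>\<bar> \<le> 1/2"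
      using r by linarith+
    ultimately have "(y 1 + \<tau> \<in> E \<and> - (1/2) \<le> \<tau> \<and> \<tau> < 1/2) \<longleftrightarrow>
        \<bar>v\<bar> \<le> s / 2 \<and> (\<forall>j\<in>{2..k}. \<bar>u j + v\<bar> \<le> s / 2)"
      using E_iff by blast
    then show ?thesis
      by (auto simp: indicator_def \<tau>_def)
  qed
  have "emeasure lborel ({0..1} \<inter> E) = (\<integral>\<^sup>+t. indicator E t * indicator {0..1} t \<partial>lborel)"
    by (simp add: nn_integral_indicator[symmetric] indicator_inter_arith mult.commute del: nn_integral_indicator)
  also have "\<dots> = (\<integral>\<^sup>+t. indicator E t * indicator {0..<1} t \<partial>lborel)"
  proof (intro nn_integral_cong_AE)
    show "AE t in lborel. indicator E t * indicator {0..1} t = (indicator E t * indicator {0..<1} t :: ennreal)"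
      using AE_lborel_singleton[of "1::real"] by eventually_elim (auto simp: indicator_def)
  qed
  also have "\<dots> = (\<integral>\<^sup>+t. indicator E t * indicator {y 1 - 1/2..<y 1 - 1/2 + 1} t \<partial>lborel)"
    by (rule nn_integral_periodic[symmetric]) (auto simp: per)
  also have "\<dots> = ennreal (1 / real N) * (\<integral>\<^sup>+v. indicator {v. \<bar>v\<bar> \<le> s / 2 \<and> (\<forall>j\<in>{2..k}. \<bar>u j + v\<bar> \<le> s / 2)} v \<partial>lborel)"
    \<comment> \<open>The substitution \<open>t = y 1 + v / N\<close> contributes the Jacobian
      \<open>1 / N\<close>.\<close>
    using N by (subst nn_integral_real_affine[where c = "1 / real N" and t = "y 1"]) (simp_all only: key, auto)
  also have "\<dots> = ennreal (overlap s {2..k} u / real N)"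
  proof (subst nn_integral_indicator)
    show "{v. \<bar>v\<bar> \<le> s / 2 \<and> (\<forall>j\<in>{2..k}. \<bar>u j + v\<bar> \<le> s / 2)} \<in> sets lborel"
      unfolding overlap_interval[OF finite_atLeastAtMost] by simp
    show "ennreal (1 / real N) * emeasure lborel {v. \<bar>v\<bar> \<le> s / 2 \<and> (\<forall>j\<in>{2..k}. \<bar>u j + v\<bar> \<le> s / 2)} =
        ennreal (overlap s {2..k} u / real N)"
      unfolding emeasure_overlap[OF finite_atLeastAtMost]
      by (simp add: ennreal_mult'[symmetric] overlap_nonneg)
  qed
  finally show ?thesis
    by (simp add: E_def r_def u_def)
qed

section \<open>Falling factorials and the counting function\<close>

lemma falling_factorial_eq_0: "n < k \<Longrightarrow> (\<Prod>j<k. real n - real j) = 0"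
  by (rule prod_zero) auto

text \<open>Truncated subtraction does no harm: for \<open>n < k\<close> the factor with
  \<open>j = n\<close> vanishes on both sides.\<close>

lemma falling_factorial_of_nat: "(\<Prod>j<k. real n - real j) = real (\<Prod>j<k. n - j)"
proof (cases "n < k")
  case True
  have "(\<Prod>j<k. n - j) = 0"
    by (rule prod_zero) (use True in auto)
  then show ?thesis
    using falling_factorial_eq_0[OF True] by (simp only: of_nat_0)
next
  case False
  then show ?thesis by (auto simp: of_nat_diff intro!: prod.cong)
qed

text \<open>Both sides count the injections of \<open>{1..k}\<close> into the indices satisfying
  \<open>P\<close>. The sum form lets the integral over \<open>t\<close> be taken tuple by
  tuple.\<close>

lemma falling_factorial_eq_sum_distinct_tuples:
  "(\<Prod>j<k. real (card {n\<in>{1..N}. P n}) - real j) =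
    (\<Sum>i\<in>distinct_tuples k N. if \<forall>j\<in>{1..k}. P (i j) then 1 else 0)"
proof -
  let ?A = "{n\<in>{1..N}. P n}"
  have fin: "finite (distinct_tuples k N)"
    unfolding distinct_tuples_def by (rule finite_subset[of _ "{1..k} \<rightarrow>\<^sub>E {1..N}"]) (auto intro: finite_PiE)
  have "(\<Prod>j<k. real (card ?A) - real j) = real (\<Prod>j<k. card ?A - j)"
    by (rule falling_factorial_of_nat)
  also have "(\<Prod>j<k. card ?A - j) = card {i \<in> {1..k} \<rightarrow>\<^sub>E ?A. inj_on i {1..k}}"
    using card_inj_on_subset_funcset[of "{1..k}" ?A "{1..k}"] by (simp add: atLeast0LessThan)
  also have "{i \<in> {1..k} \<rightarrow>\<^sub>E ?A. inj_on i {1..k}} = {i \<in> distinct_tuples k N. \<forall>j\<in>{1..k}. P (i j)}"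
    unfolding distinct_tuples_def by (auto simp: PiE_iff)
  also have "real (card \<dots>) = (\<Sum>i\<in>distinct_tuples k N. if \<forall>j\<in>{1..k}. P (i j) then 1 else 0)"
    using fin by (simp add: sum.If_cases Int_def)
  finally show ?thesis .
qed

lemma F_count_measurable [measurable]: "(\<lambda>t. real (F_count x t s N)) \<in> borel_measurable borel"
proof -
  have "real (F_count x t s N) = (\<Sum>n\<in>{1..N}. if dist_int (x n - t) \<le> s / (2 * real N) then 1 else 0)" for t
    by (simp add: F_count_def sum.If_cases Int_def)
  then show ?thesis by simp
qed

lemma F_count_le: "F_count x t s N \<le> N"
  unfolding F_count_def by (rule order_trans[OF card_mono[of "{1..N}"]]) auto

text \<open>The count takes values in \<open>{..N}\<close> only, so \<open>p\<close> of it is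
  bounded; continuity of \<open>p\<close> gives measurability. Powers and falling factorials are
  both instances.\<close>

lemma set_integrable_F_count:
  assumes "continuous_on UNIV (p :: real \<Rightarrow> real)"
  shows "set_integrable lborel {0..1} (\<lambda>t. p (real (F_count x t s N)))"
proof -
  have [measurable]: "p \<in> borel_measurable borel"
    using assms by (rule borel_measurable_continuous_onI)
  define B where "B = Max ((\<lambda>n. \<bar>p (real n)\<bar>) ` {..N})"
  have "\<bar>p (real (F_count x t s N))\<bar> \<le> B" for t
    unfolding B_def using F_count_le[of x t s N] by (intro Max_ge) auto
  moreover have "finite_measure (restrict_space lborel {0..1::real})"
    by (rule finite_measureI) (simp add: emeasure_restrict_space)
  ultimately have "integrable (restrict_space lborel {0..1}) (\<lambda>t. p (real (F_count x t s N)))"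
    by (intro finite_measure.integrable_const_bound[where B = B])
      (auto intro!: measurable_restrict_space1)
  then show ?thesis
    by (subst (asm) integrable_restrict_space) (auto simp: set_integrable_def)
qed

section \<open>Factorial integrals as correlation sums, and their limit\<close>

lemma I_fact_eq_corr:
  assumes k: "k \<ge> 1" and N: "real N > 2 * s" "N > 0"
  shows "I_fact x k s N = corr x k (overlap s {2..k}) N"
proof -
  define E where "E i = {t. \<forall>j\<in>{1..k}. dist_int (x (i j) - t) \<le> s / (2 * real N)}" for i :: "nat \<Rightarrow> nat"
  have [measurable]: "E i \<in> sets borel" for i
    unfolding E_def by measurable
  have em: "emeasure lborel ({0..1} \<inter> E i) =
      ennreal (overlap s {2..k} (\<lambda>j\<in>{2..k}. real N * signed_dist (x (i 1) - x (i j))) / real N)" for i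
    unfolding E_def by (rule emeasure_arcs[OF k N, of "\<lambda>j. x (i j)"])
  have "I_fact x k s N = (LINT t|lborel. (\<Sum>i\<in>distinct_tuples k N. indicator ({0..1} \<inter> E i) t))"
    unfolding I_fact_def F_count_def falling_factorial_eq_sum_distinct_tuples set_lebesgue_integral_def
    by (intro Bochner_Integration.integral_cong)
      (auto simp: sum_distrib_left indicator_def E_def intro!: sum.cong)
  also have "\<dots> = (\<Sum>i\<in>distinct_tuples k N. measure lborel ({0..1} \<inter> E i))"
    by (subst Bochner_Integration.integral_sum) (auto simp: em)
  also have "\<dots> = corr x k (overlap s {2..k}) N"
    unfolding corr_def sum_distrib_left measure_def em
    by (intro sum.cong) (auto simp: overlap_nonneg)
  finally show ?thesis .
qed

text \<open>The identity with the correlation sum holds once \<open>N > 2 * s\<close>, hence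
  eventually. The case \<open>k = 1\<close> is included because the Stirling expansion has a linear
  term.\<close>

lemma I_fact_tendsto:
  assumes "k \<ge> 1" "poissonian_correlations k x" "s > 0"
  shows "(\<lambda>N. I_fact x k s N) \<longlonglongrightarrow> s ^ k"
proof -
  have "(\<lambda>N. corr x k (overlap s {2..k}) N) \<longlonglongrightarrow> (LINT u|Pi\<^sub>M {2..k} (\<lambda>_. lborel). overlap s {2..k} u)"
    using assms(2) overlap_in_nonneg_Cc[of "{2..k}" s] by (auto simp: poissonian_correlations_def)
  moreover have "(LINT u|Pi\<^sub>M {2..k} (\<lambda>_. lborel). overlap s {2..k} u) = s ^ k"
    using assms by (subst integral_overlap) auto
  moreover have "eventually (\<lambda>N. corr x k (overlap s {2..k}) N = I_fact x k s N) sequentially"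
    using eventually_gt_at_top[of "nat \<lceil>2 * s\<rceil>"] eventually_gt_at_top[of 0]
    by eventually_elim (rule I_fact_eq_corr[symmetric], use assms in \<open>auto, linarith\<close>)
  ultimately show ?thesis
    using tendsto_cong by fastforce
qed

section \<open>First-order correlations and the Stirling expansion\<close>

text \<open>
  For \<open>k = 1\<close> the test functions live on a one-point space, so the top-order and linear
  terms of the Stirling expansion can be treated alike.
\<close>

lemma poissonian_correlations_1: "poissonian_correlations 1 x"
proof -
  have *: "distinct_tuples 1 N = {1::nat} \<rightarrow>\<^sub>E {1..N}" for N
    by (auto simp: distinct_tuples_def)
  \<comment> \<open>The index set \<open>{2..1}\<close> is empty, so every tuple is mapped to the
    constant function \<open>undefined\<close>, and the \<open>N\<close> tuples cancel the factor
    \<open>1 / N\<close>.\<close>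
  have "corr x 1 f N = f (\<lambda>_. undefined)" if "N > 0" for f N
    using that unfolding corr_def * by (simp add: restrict_def card_PiE)
  then have "(\<lambda>N. corr x 1 f N) \<longlonglongrightarrow> f (\<lambda>_. undefined)" for f
    by (intro tendsto_eventually eventually_mono[OF eventually_gt_at_top[of 0]])
  moreover have "(LINT u|Pi\<^sub>M {} (\<lambda>_. lborel :: real measure). f u) = f (\<lambda>_. undefined)" for f :: "(nat \<Rightarrow> real) \<Rightarrow> real"
    by (simp add: PiM_empty lebesgue_integral_count_space_finite)
  ultimately show ?thesis
    by (simp add: poissonian_correlations_def)
qed

text \<open>The identity \<open>a * p i = p (Suc i) + i * p i\<close> for falling factorials
  \<open>p\<close> matches the recurrence of the Stirling numbers.\<close>

lemma power_eq_sum_Stirling: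
  "(a :: 'a :: comm_ring_1) ^ n = (\<Sum>i\<le>n. of_nat (Stirling n i) * (\<Prod>j<i. a - of_nat j))"
proof (induction n)
  case (Suc n)
  let ?p = "\<lambda>i. \<Prod>j<i. a - of_nat j"
  let ?S = "\<lambda>i. of_nat (Stirling n i) :: 'a"
  have "(\<Sum>i\<le>Suc n. of_nat (Stirling (Suc n) i) * ?p i)
      = (\<Sum>i\<le>n. of_nat (Suc i) * ?S (Suc i) * ?p (Suc i) + ?S i * ?p (Suc i))"
    \<comment> \<open>The term for index 0 drops out because
      \<open>Stirling (Suc n) 0 = 0\<close>.\<close>
    by (subst sum.atMost_Suc_shift) (simp del: prod.lessThan_Suc add: algebra_simps)
  also have "\<dots> = (\<Sum>i\<le>n. of_nat (Suc i) * ?S (Suc i) * ?p (Suc i)) + (\<Sum>i\<le>n. ?S i * ?p (Suc i))"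
    by (rule sum.distrib)
  also have "(\<Sum>i\<le>n. of_nat (Suc i) * ?S (Suc i) * ?p (Suc i)) = (\<Sum>i\<le>Suc n. of_nat i * ?S i * ?p i)"
    by (subst sum.atMost_Suc_shift) simp
  \<comment> \<open>The top term vanishes since \<open>Stirling n (Suc n) = 0\<close>.\<close>
  also have "\<dots> = (\<Sum>i\<le>n. of_nat i * ?S i * ?p i)"
    by simp
  also have "\<dots> + (\<Sum>i\<le>n. ?S i * ?p (Suc i)) = a * (\<Sum>i\<le>n. ?S i * ?p i)"
    by (simp add: sum.distrib[symmetric] sum_distrib_left algebra_simps)
  finally show ?case
    using Suc.IH by simp
qed simp

lemma I_star_eq_sum_I_fact: "I_star x k s N = (\<Sum>i\<le>k. real (Stirling k i) * I_fact x i s N)"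
proof -
  have int: "set_integrable lborel {0..1} (\<lambda>t. \<Prod>j<i. real (F_count x t s N) - real j)" for i
    by (rule set_integrable_F_count[of "\<lambda>a. \<Prod>j<i. a - real j"]) (intro continuous_intros)
  have "I_star x k s N = (LINT t:{0..1}|lborel. \<Sum>i\<le>k. real (Stirling k i) * (\<Prod>j<i. real (F_count x t s N) - real j))"
    unfolding I_star_def by (subst power_eq_sum_Stirling) simp
  also have "\<dots> = (\<Sum>i\<le>k. real (Stirling k i) * I_fact x i s N)"
    unfolding I_fact_def set_lebesgue_integral_def sum_distrib_left scaleR_sum_right
    using int by (subst Bochner_Integration.integral_sum) (auto simp: set_integrable_def mult.left_commute)
  finally show ?thesis .
qed

lemma I_star_tendsto:
  assumes "k \<ge> 1" "\<forall>l\<in>{2..k}. poissonian_correlations l x" "s > 0"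
  shows "(\<lambda>N. I_star x k s N) \<longlonglongrightarrow> s ^ k + (\<Sum>i=1..k-1. real (Stirling k i) * s ^ i)"
proof -
  have "poissonian_correlations i x" if "1 \<le> i" "i \<le> k" for i
    using assms(2) that poissonian_correlations_1 by (cases "i = 1") auto
  then have "(\<lambda>N. I_fact x i s N) \<longlonglongrightarrow> s ^ i" if "1 \<le> i" "i \<le> k" for i
    using that assms by (intro I_fact_tendsto) auto
  then have "(\<lambda>N. \<Sum>i=1..k. real (Stirling k i) * I_fact x i s N) \<longlonglongrightarrow> (\<Sum>i=1..k. real (Stirling k i) * s ^ i)"
    by (intro tendsto_intros) auto
  moreover have "(\<Sum>i=1..k. real (Stirling k i) * s ^ i) = s ^ k + (\<Sum>i=1..k-1. real (Stirling k i) * s ^ i)"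
    using assms(1) by (cases k) auto
  \<comment> \<open>The term \<open>i = 0\<close> disappears because \<open>Stirling k 0 = 0\<close>
    for \<open>k \<ge> 1\<close>.\<close>
  moreover have "I_star x k s N = (\<Sum>i=1..k. real (Stirling k i) * I_fact x i s N)" for N
    using assms(1) unfolding I_star_eq_sum_I_fact
    by (cases k) (auto simp: atMost_atLeast0 sum.atLeast_Suc_atMost)
  ultimately show ?thesis by simp
qed

section \<open>Comparison of moments and the upper limit\<close>

lemma falling_factorial_le_power: "(\<Prod>j<k. real n - real j) \<le> real n ^ k"
proof -
  have "(\<Prod>j<k. n - j) \<le> n ^ k"
    using prod_mono[of "{..<k}" "\<lambda>j. n - j" "\<lambda>_. n"] by simp
  then show ?thesis
    unfolding falling_factorial_of_nat by (metis of_nat_le_iff of_nat_power)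
qed

text \<open>For \<open>n \<ge> k\<close> every factor is at least \<open>n - k\<close>, and
  Bernoulli's inequality bounds \<open>(1 - k/n)^k\<close> below by \<open>1 - k^2/n\<close>. For
  \<open>n < k\<close> the product is 0 and \<open>n \<le> k^2\<close> suffices.\<close>

lemma power_le_falling_factorial_add:
  assumes "k \<ge> 1"
  shows "real n ^ k \<le> (\<Prod>j<k. real n - real j) + real k ^ 2 * real n ^ (k - 1)"
proof (cases "n < k")
  case True
  have "real n \<le> real k ^ 2"
    using True by (metis le_square less_imp_le of_nat_le_iff of_nat_power order_trans power2_eq_square)
  then have "real n * real n ^ (k - 1) \<le> real k ^ 2 * real n ^ (k - 1)"
    by (intro mult_right_mono) auto
  moreover have "real n * real n ^ (k - 1) = real n ^ k"
    using assms by (cases k) auto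
  ultimately show ?thesis
    using falling_factorial_eq_0[OF True] by linarith
next
  case False
  then have n: "real n \<ge> real k" "real n > 0" using assms by auto
  have "real n ^ k - real k ^ 2 * real n ^ (k - 1) = real n ^ k * (1 + real k * (- (real k / real n)))"
    using n assms by (cases k) (auto simp: field_simps power2_eq_square)
  also have "\<dots> \<le> real n ^ k * (1 + - (real k / real n)) ^ k"
    using n by (intro mult_left_mono Bernoulli_inequality) auto
  also have "\<dots> = (real n - real k) ^ k"
    using n by (simp add: power_mult_distrib[symmetric] field_simps)
  also have "\<dots> \<le> (\<Prod>j<k. real n - real j)"
    using n prod_mono[of "{..<k}" "\<lambda>_. real n - real k" "\<lambda>j. real n - real j"] by simp
  finally show ?thesis by simp
qed

text \<open>The first term dominates for \<open>a \<le> s\<close>, the second for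
  \<open>a > s\<close>. No control of correlations of order \<open>k - 1\<close> is then
  required.\<close>

lemma power_le_power_add:
  fixes a s :: real
  assumes "k \<ge> 1" "0 \<le> a" "0 < s"
  shows "a ^ (k - 1) \<le> s ^ (k - 1) + a ^ k / s"
proof (cases "a \<le> s")
  case True
  then have "a ^ (k - 1) \<le> s ^ (k - 1)" using assms by (intro power_mono) auto
  then show ?thesis using assms by (simp add: add_increasing2)
next
  case False
  then have "s * a ^ (k - 1) \<le> a * a ^ (k - 1)" using assms by (intro mult_right_mono) auto
  then have "a ^ (k - 1) \<le> a ^ k / s"
    using assms by (cases k) (auto simp: field_simps)
  then show ?thesis using assms by (simp add: add_increasing)
qed

lemma I_fact_le_I_star: "I_fact x k s N \<le> I_star x k s N"
  unfolding I_fact_def I_star_def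
proof (rule set_integral_mono)
  show "set_integrable lborel {0..1} (\<lambda>t. \<Prod>j<k. real (F_count x t s N) - real j)"
    by (rule set_integrable_F_count[of "\<lambda>a. \<Prod>j<k. a - real j"]) (intro continuous_intros)
  show "set_integrable lborel {0..1} (\<lambda>t. real (F_count x t s N) ^ k)"
    by (rule set_integrable_F_count[of "\<lambda>a. a ^ k"]) (intro continuous_intros)
qed (rule falling_factorial_le_power)

text \<open>The two preceding pointwise bounds are combined, and the part
  \<open>k^2 * F^k / s\<close> is moved to the left-hand side.\<close>

lemma I_star_le:
  assumes k: "k \<ge> 1" and s: "s > 0"
  shows "I_star x k s N * (1 - real k ^ 2 / s) \<le> I_fact x k s N + real k ^ 2 * s ^ (k - 1)"
proof -
  let ?F = "\<lambda>t. real (F_count x t s N)"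
  have int: "set_integrable lborel {0..1} (\<lambda>t. \<Prod>j<k. ?F t - real j)"
    by (rule set_integrable_F_count[of "\<lambda>a. \<Prod>j<k. a - real j"]) (intro continuous_intros)
  have "I_star x k s N * (1 - real k ^ 2 / s) = (LINT t:{0..1}|lborel. ?F t ^ k * (1 - real k ^ 2 / s))"
    by (simp add: I_star_def)
  also have "\<dots> \<le> (LINT t:{0..1}|lborel. (\<Prod>j<k. ?F t - real j) + real k ^ 2 * s ^ (k - 1))"
  proof (rule set_integral_mono)
    show "set_integrable lborel {0..1} (\<lambda>t. ?F t ^ k * (1 - real k ^ 2 / s))"
      by (rule set_integrable_F_count[of "\<lambda>a. a ^ k * (1 - real k ^ 2 / s)"]) (intro continuous_intros)
    show "set_integrable lborel {0..1} (\<lambda>t. (\<Prod>j<k. ?F t - real j) + real k ^ 2 * s ^ (k - 1))"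
      by (rule set_integrable_F_count[of "\<lambda>a. (\<Prod>j<k. a - real j) + real k ^ 2 * s ^ (k - 1)"])
        (intro continuous_intros)
  next
    fix t
    have "?F t ^ k \<le> (\<Prod>j<k. ?F t - real j) + real k ^ 2 * ?F t ^ (k - 1)"
      by (rule power_le_falling_factorial_add[OF k])
    also have "\<dots> \<le> (\<Prod>j<k. ?F t - real j) + real k ^ 2 * (s ^ (k - 1) + ?F t ^ k / s)"
      using k s by (intro add_left_mono mult_left_mono power_le_power_add) auto
    finally show "?F t ^ k * (1 - real k ^ 2 / s) \<le> (\<Prod>j<k. ?F t - real j) + real k ^ 2 * s ^ (k - 1)"
      by (simp add: algebra_simps)
  qed
  also have "\<dots> = I_fact x k s N + real k ^ 2 * s ^ (k - 1)"
    unfolding I_fact_def by (subst set_integral_add) (use int in \<open>auto simp: set_lebesgue_integral_def set_integrable_def\<close>)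
  finally show ?thesis .
qed

text \<open>The lower bound is \<open>I_fact \<le> I_star\<close>. For the upper one,
  \<open>s \<ge> 2 * k^2\<close> makes the factor \<open>1 - k^2/s\<close> at least 1/2, so it can
  be divided out.\<close>

lemma limsup_I_star:
  assumes k: "k \<ge> 1" and s: "s \<ge> 2 * real k ^ 2" and lim: "(\<lambda>N. I_fact x k s N) \<longlonglongrightarrow> s ^ k"
  shows "\<bar>limsup (\<lambda>N. ereal (I_star x k s N)) - ereal (s ^ k)\<bar> \<le> ereal (4 * real k ^ 2 * s ^ (k - 1))"
proof -
  define q where "q = real k ^ 2"
  have q: "q \<ge> 1" using k by (simp add: q_def)
  have s0: "s > 0" "q / s \<le> 1/2" using q s by (auto simp: q_def[symmetric] field_simps)
  have sk: "s ^ k = s * s ^ (k - 1)" using k by (cases k) auto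
  define B where "B = (s ^ k + q * s ^ (k - 1)) / (1 - q / s)"
  have lower: "ereal (s ^ k) \<le> limsup (\<lambda>N. ereal (I_star x k s N))"
  proof -
    have "ereal (s ^ k) = limsup (\<lambda>N. ereal (I_fact x k s N))"
      using lim by (intro lim_imp_Limsup[symmetric]) auto
    also have "\<dots> \<le> limsup (\<lambda>N. ereal (I_star x k s N))"
      by (intro Limsup_mono) (simp add: I_fact_le_I_star)
    finally show ?thesis .
  qed
  have upper: "limsup (\<lambda>N. ereal (I_star x k s N)) \<le> ereal B"
  proof -
    have "limsup (\<lambda>N. ereal (I_star x k s N)) \<le> limsup (\<lambda>N. ereal ((I_fact x k s N + q * s ^ (k - 1)) / (1 - q / s)))"
      using I_star_le[OF k s0(1), of x] s0
      by (intro Limsup_mono always_eventually) (auto simp: q_def[symmetric] pos_le_divide_eq)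
    also have "\<dots> = ereal B"
      unfolding B_def using s0 lim by (intro lim_imp_Limsup tendsto_intros tendsto_ereal) auto
    finally show ?thesis .
  qed
  \<comment> \<open>After cancelling \<open>s ^ (k - 1)\<close>, a constant \<open>c\<close> in
    place of 4 must satisfy \<open>c * (1 - q/s) \<ge> 2\<close>; as \<open>q/s \<le> 1/2\<close>,
    \<open>c = 4\<close> works.\<close>
  have "B \<le> s ^ k + 4 * q * s ^ (k - 1)"
  proof -
    have "4 * q \<ge> 2 * q + 4 * q * (q / s)"
      using mult_left_mono[OF s0(2), of "4 * q"] q by simp
    then have "s + q \<le> (s + 4 * q) * (1 - q / s)"
      using s0 q by (simp add: algebra_simps)
    then have "s ^ (k - 1) * (s + q) \<le> s ^ (k - 1) * ((s + 4 * q) * (1 - q / s))"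
      using s0 by (intro mult_left_mono) auto
    then show ?thesis
      unfolding B_def sk using s0 by (simp add: pos_divide_le_eq algebra_simps)
  qed
  with upper have "limsup (\<lambda>N. ereal (I_star x k s N)) \<le> ereal (s ^ k + 4 * q * s ^ (k - 1))"
    by (meson ereal_less_eq(3) order_trans)
  with lower show ?thesis
    \<comment> \<open>The two bounds exclude infinite values of the upper limit.\<close>
    by (cases "limsup (\<lambda>N. ereal (I_star x k s N))") (auto simp: q_def)
qed

theorem theorem5:
  fixes k :: nat
  assumes "k \<ge> 2"
  shows "\<exists>C>0. \<exists>s\<^sub>0>0. \<forall>x :: nat \<Rightarrow> real.
    (\<forall>n\<ge>1. x n \<in> {0..1}) \<and> poissonian_correlations k x \<longrightarrow>
      (\<forall>s>0. (\<lambda>N. I_fact x k s N) \<longlonglongrightarrow> s ^ k) \<and>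
      (\<forall>s\<ge>s\<^sub>0. \<bar>limsup (\<lambda>N. ereal (I_star x k s N)) - ereal (s ^ k)\<bar> \<le> ereal (C * s ^ (k - 1))) \<and>
      ((\<forall>l\<in>{2..k}. poissonian_correlations l x) \<longrightarrow>
        (\<forall>s>0. (\<lambda>N. I_star x k s N) \<longlonglongrightarrow>
                 s ^ k + (\<Sum>i=1..k-1. real (Stirling k i) * s ^ i)))"
proof (intro exI conjI allI impI)
  \<comment> \<open>The witnesses are \<open>C = 4 * k^2\<close> and \<open>2 * k^2\<close> for the
    threshold; they depend on \<open>k\<close> alone, not on the sequence.\<close>
  show "4 * real k ^ 2 > 0" "2 * real k ^ 2 > 0"
    using assms by auto
next
  fix x :: "nat \<Rightarrow> real" and s :: real
  assume x: "(\<forall>n\<ge>1. x n \<in> {0..1}) \<and> poissonian_correlations k x"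
  show "(\<lambda>N. I_fact x k s N) \<longlonglongrightarrow> s ^ k" if "s > 0"
    using x assms that by (intro I_fact_tendsto) auto
  show "\<bar>limsup (\<lambda>N. ereal (I_star x k s N)) - ereal (s ^ k)\<bar> \<le> ereal (4 * real k ^ 2 * s ^ (k - 1))"
    if "2 * real k ^ 2 \<le> s"
  proof (rule limsup_I_star)
    have "0 < 2 * real k ^ 2" using assms by auto
    then have "s > 0" using that by linarith
    then show "(\<lambda>N. I_fact x k s N) \<longlonglongrightarrow> s ^ k"
      using x assms by (intro I_fact_tendsto) auto
  qed (use assms that in auto)
  show "(\<lambda>N. I_star x k s N) \<longlonglongrightarrow> s ^ k + (\<Sum>i=1..k-1. real (Stirling k i) * s ^ i)"
    if "\<forall>l\<in>{2..k}. poissonian_correlations l x" "s > 0"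
    using that assms by (intro I_star_tendsto) auto
qed

end
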